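(* For every integer $n\geq 1$, \[ e_{n}=\sum_{|\lambda|=n}\varepsilon_{\lambda}\,[z_{\lambda}]_{q}^{-1}\,[p_{\lambda}]_{q}, \] where the sum is over all integer partitions $\lambda$ of $n$, $\varepsilon_\lambda=(-1)^{|\lambda|-l(\lambda)}$, and for a partition $\lambda=(\lambda_1,\dots,\lambda_r)$ of $n$, \[ [z_{\lambda}]_{q}=\Big(\sum_{u}\big([n]_q[n-u_{1}]_q[n-u_{1}-u_{2}]_q\cdots[n-u_1-\cdots-u_{r-1}]_q\big)^{-1}\Big)^{-1}, \] the sum being over all distinct permutations $u=(u_1,\dots,u_r)$ of the sequence $(\lambda_1,\dots,\lambda_r)$ (note that the last factor $[n-u_1-\cdots-u_{r-1}]_q=[u_r]_q$).
   Context: Let $q$ be an indeterminate and $K$ a field containing $\mathbb{Q}(q)$. $\Lambda_K$ is the algebra of symmetric functions in indeterminates $x_1,x_2,\dots$ with coefficients in $K$; $e_n$ denotes the elementary symmetric function ($e_0=1$) and $E(t)=\sum_{n\geq0}e_nt^n\in\Lambda_K[[t]]$. For $n\in\mathbb{N}$, $[n]_q=1+q+\cdots+q^{n-1}$ for $n\ge1$, $[0]_q=0$. For a formal power series $F(t)$, $D_qF(t)=\dfrac{F(qt)-F(t)}{(q-1)t}$. The $q$-power sums $[p_n]_q\in\Lambda_K$ ($n\geq1$) are defined by $\sum_{n\geq1}[p_n]_q(-t)^{n-1}=D_qE(t)/E(t)$, and for a partition $\lambda=(\lambda_1,\dots,\lambda_r)$, $[p_\lambda]_q=[p_{\lambda_1}]_q\cdots[p_{\lambda_r}]_q$.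 For a partition $\lambda$, $|\lambda|$ is the sum of its parts and $l(\lambda)$ its number of parts. *)

theory Defs
  imports
    "HOL-Computational_Algebra.Computational_Algebra"
    "HOL-Combinatorics.Combinatorics"
begin

text \<open>
  A multiset \<open>m\<close> of natural numbers encodes the monomial whose exponent of the \<open>i\<close>-th
  indeterminate is \<open>count m i\<close> (the indeterminates are indexed from 0).  Its degree is
  \<open>size m\<close>, and the product of monomials is the sum of multisets.
  A symmetric function is a formal, possibly infinite, linear combination of monomials, given by
  its coefficients, that has bounded degree and is invariant under permutations of the
  indeterminates.
\<close>

typedef (overloaded) 'a symfun =
  "{f :: nat multiset \<Rightarrow> 'a :: zero.
      (\<exists>d. \<forall>m. size m > d \<longrightarrow> f m = 0) \<and> (\<forall>\<pi> m. bij \<pi> \<longrightarrow> f (image_mset \<pi> m) = f m)}"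
  morphisms symfun_coeff Abs_symfun
  by (rule exI[of _ "\<lambda>_. 0"]) simp

setup_lifting type_definition_symfun

lemma symfun_eqI: "(\<And>m. symfun_coeff f m = symfun_coeff g m) \<Longrightarrow> f = g"
  by (simp add: symfun_coeff_inject[symmetric] fun_eq_iff)

definition splits :: "nat multiset \<Rightarrow> (nat multiset \<times> nat multiset) set" where
  "splits m = {(a, b). a + b = m}"

lemma finite_submultisets: "finite {a. a \<subseteq># (m :: 'b multiset)}"
proof (induction m)
  case (add x m)
  have "{a. a \<subseteq># add_mset x m} \<subseteq> {a. a \<subseteq># m} \<union> add_mset x ` {a. a \<subseteq># m}"
  proof
    fix a assume "a \<in> {a. a \<subseteq># add_mset x m}"
    hence a: "a \<subseteq># add_mset x m" by simp
    show "a \<in> {a. a \<subseteq># m} \<union> add_mset x ` {a. a \<subseteq># m}"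
    proof (cases "x \<in># a")
      case True
      then obtain b where "a = add_mset x b" by (meson mset_add)
      with a show ?thesis by auto
    next
      case False
      with a have "a \<subseteq># m"
        by (metis add_mset_remove_trivial diff_single_trivial subset_eq_diff_conv
              add_mset_add_single)
      thus ?thesis by simp
    qed
  qed
  with add show ?case by (meson finite_Un finite_imageI finite_subset)
qed simp

lemma finite_splits [simp, intro]: "finite (splits m)"
proof (rule finite_subset)
  show "splits m \<subseteq> {a. a \<subseteq># m} \<times> {a. a \<subseteq># m}" by (auto simp: splits_def)
  show "finite ({a. a \<subseteq># m} \<times> {a. a \<subseteq># m})" by (simp add: finite_submultisets)
qed

lemma splits_empty [simp]: "splits {#} = {({#}, {#})}"
  by (auto simp: splits_def)

lemma sum_splits_swap:
  "(\<Sum>(a, b)\<in>splits m. h a b) = (\<Sum>(a, b)\<in>splits m. h b a)"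
  by (rule sum.reindex_bij_witness[of _ prod.swap prod.swap])
     (auto simp: splits_def add.commute)

lemma sum_splits_assoc:
  fixes h :: "nat multiset \<Rightarrow> nat multiset \<Rightarrow> nat multiset \<Rightarrow> 'b :: comm_monoid_add"
  shows "(\<Sum>(a, b)\<in>splits m. \<Sum>(c, d)\<in>splits a. h c d b) =
         (\<Sum>(a, b)\<in>splits m. \<Sum>(c, d)\<in>splits b. h a c d)"
proof -
  have "(\<Sum>(a, b)\<in>splits m. \<Sum>(c, d)\<in>splits a. h c d b) =
        (\<Sum>((a, b), (c, d))\<in>(SIGMA p:splits m. splits (fst p)). h c d b)"
    by (subst sum.Sigma[symmetric]) (auto simp: case_prod_beta)
  also have "\<dots> = (\<Sum>((a, b), (c, d))\<in>(SIGMA p:splits m. splits (snd p)). h a c d)"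
    by (rule sum.reindex_bij_witness[of _
          "\<lambda>((a, b), (c, d)). ((a + c, d), (a, c))" "\<lambda>((a, b), (c, d)). ((c, d + b), (d, b))"])
       (auto simp: splits_def add.assoc)
  also have "\<dots> = (\<Sum>(a, b)\<in>splits m. \<Sum>(c, d)\<in>splits b. h a c d)"
    by (subst sum.Sigma[symmetric]) (auto simp: case_prod_beta)
  finally show ?thesis .
qed

lemma image_mset_inv_cancel:
  assumes "bij \<pi>"
  shows "image_mset (inv \<pi>) (image_mset \<pi> m) = m" "image_mset \<pi> (image_mset (inv \<pi>) m) = m"
  using assms by (auto simp: multiset.map_comp bij_is_inj bij_is_surj surj_iff[THEN iffD1])

lemma sum_splits_image:
  assumes "bij \<pi>"
  shows "(\<Sum>(a, b)\<in>splits (image_mset \<pi> m). h a b) =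
         (\<Sum>(a, b)\<in>splits m. h (image_mset \<pi> a) (image_mset \<pi> b))"
  by (rule sum.reindex_bij_witness[of _ "map_prod (image_mset \<pi>) (image_mset \<pi>)"
        "map_prod (image_mset (inv \<pi>)) (image_mset (inv \<pi>))"])
     (use assms in \<open>auto simp: splits_def image_mset_inv_cancel image_mset_union[symmetric]
        simp del: image_mset_union\<close>)

instantiation symfun :: (comm_ring_1) comm_ring_1
begin

lift_definition zero_symfun :: "'a symfun" is "\<lambda>_. 0"
  by simp

lift_definition one_symfun :: "'a symfun" is "\<lambda>m. if m = {#} then 1 else 0"
  by (auto intro!: exI[of _ 0])

lift_definition plus_symfun :: "'a symfun \<Rightarrow> 'a symfun \<Rightarrow> 'a symfun" is "\<lambda>f g m. f m + g m"
proof -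
  fix f g :: "nat multiset \<Rightarrow> 'a"
  assume f: "(\<exists>d. \<forall>m. size m > d \<longrightarrow> f m = 0) \<and> (\<forall>\<pi> m. bij \<pi> \<longrightarrow> f (image_mset \<pi> m) = f m)"
    and g: "(\<exists>d. \<forall>m. size m > d \<longrightarrow> g m = 0) \<and> (\<forall>\<pi> m. bij \<pi> \<longrightarrow> g (image_mset \<pi> m) = g m)"
  then obtain d e where "\<forall>m. size m > d \<longrightarrow> f m = 0" "\<forall>m. size m > e \<longrightarrow> g m = 0" by blast
  hence "\<forall>m. size m > max d e \<longrightarrow> f m + g m = 0" by simp
  with f g show "(\<exists>d. \<forall>m. size m > d \<longrightarrow> f m + g m = 0) \<and>
    (\<forall>\<pi> m. bij \<pi> \<longrightarrow> f (image_mset \<pi> m) + g (image_mset \<pi> m) = f m + g m)"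
    by (intro conjI exI[of _ "max d e"]) simp_all
qed

lift_definition uminus_symfun :: "'a symfun \<Rightarrow> 'a symfun" is "\<lambda>f m. - f m"
  by auto

definition minus_symfun :: "'a symfun \<Rightarrow> 'a symfun \<Rightarrow> 'a symfun" where
  "minus_symfun f g = f + - g"

lift_definition times_symfun :: "'a symfun \<Rightarrow> 'a symfun \<Rightarrow> 'a symfun" is
  "\<lambda>f g m. \<Sum>(a, b)\<in>splits m. f a * g b"
proof -
  fix f g :: "nat multiset \<Rightarrow> 'a"
  assume f: "(\<exists>d. \<forall>m. size m > d \<longrightarrow> f m = 0) \<and> (\<forall>\<pi> m. bij \<pi> \<longrightarrow> f (image_mset \<pi> m) = f m)"
    and g: "(\<exists>d. \<forall>m. size m > d \<longrightarrow> g m = 0) \<and> (\<forall>\<pi> m. bij \<pi> \<longrightarrow> g (image_mset \<pi> m) = g m)"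
  then obtain d e where d: "\<forall>m. size m > d \<longrightarrow> f m = 0" and e: "\<forall>m. size m > e \<longrightarrow> g m = 0"
    by blast
  have "(\<Sum>(a, b)\<in>splits m. f a * g b) = 0" if "size m > d + e" for m
  proof (rule sum.neutral, safe)
    fix a b assume "(a, b) \<in> splits m"
    hence "size m = size a + size b" by (auto simp: splits_def)
    with that have "size a > d \<or> size b > e" by linarith
    with d e show "f a * g b = 0" by auto
  qed
  moreover have "(\<Sum>(a, b)\<in>splits (image_mset \<pi> m). f a * g b) = (\<Sum>(a, b)\<in>splits m. f a * g b)"
    if "bij \<pi>" for \<pi> m
    using f g that by (simp add: sum_splits_image)
  ultimately show "(\<exists>d. \<forall>m. size m > d \<longrightarrow> (\<Sum>(a, b)\<in>splits m. f a * g b) = 0) \<and>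
    (\<forall>\<pi> m. bij \<pi> \<longrightarrow> (\<Sum>(a, b)\<in>splits (image_mset \<pi> m). f a * g b) =
      (\<Sum>(a, b)\<in>splits m. f a * g b))"
    by blast
qed

instance
proof
  fix f g h :: "'a symfun"
  show "f + g + h = f + (g + h)" by transfer (simp add: add.assoc)
  show "f + g = g + f" by transfer (simp add: add.commute)
  show "0 + f = f" by transfer simp
  show "- f + f = 0" by transfer simp
  show "f - g = f + - g" by (simp add: minus_symfun_def)
  show "f * g * h = f * (g * h)"
  proof (rule symfun_eqI)
    fix m
    let ?c = symfun_coeff
    have "?c (f * g * h) m = (\<Sum>(a, b)\<in>splits m. \<Sum>(c, d)\<in>splits a. ?c f c * ?c g d * ?c h b)"
      by (simp add: times_symfun.rep_eq sum_distrib_right case_prod_beta)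
    also have "\<dots> = (\<Sum>(a, b)\<in>splits m. \<Sum>(c, d)\<in>splits b. ?c f a * ?c g c * ?c h d)"
      by (rule sum_splits_assoc)
    also have "\<dots> = ?c (f * (g * h)) m"
      by (simp add: times_symfun.rep_eq sum_distrib_left case_prod_beta mult.assoc)
    finally show "?c (f * g * h) m = ?c (f * (g * h)) m" .
  qed
  show "f * g = g * f"
    by (rule symfun_eqI)
       (simp add: times_symfun.rep_eq mult.commute
          sum_splits_swap[where h = "\<lambda>a b. symfun_coeff f a * symfun_coeff g b"])
  show "1 * f = f"
  proof (rule symfun_eqI)
    fix m
    have "symfun_coeff (1 * f) m =
          (\<Sum>p\<in>splits m. if p = ({#}, m) then symfun_coeff f m else 0)"
      unfolding times_symfun.rep_eq one_symfun.rep_eq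
      by (rule sum.cong) (auto simp: splits_def split: if_splits)
    moreover have "({#}, m) \<in> splits m" by (simp add: splits_def)
    ultimately show "symfun_coeff (1 * f) m = symfun_coeff f m" by simp
  qed
  show "(f + g) * h = f * h + g * h"
    by (rule symfun_eqI)
       (simp add: times_symfun.rep_eq plus_symfun.rep_eq distrib_right sum.distrib case_prod_beta)
  show "(0 :: 'a symfun) \<noteq> 1"
  proof
    assume "(0 :: 'a symfun) = 1"
    hence "symfun_coeff (0 :: 'a symfun) {#} = symfun_coeff 1 {#}" by simp
    thus False by (simp add: zero_symfun.rep_eq one_symfun.rep_eq)
  qed
qed

end

lift_definition symfun_scale :: "'a :: comm_ring_1 \<Rightarrow> 'a symfun \<Rightarrow> 'a symfun"
  is "\<lambda>c f m. c * f m"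
  by fastforce

lemma module_symfun_scale: "module (symfun_scale :: 'a :: comm_ring_1 \<Rightarrow> _)"
  by standard (rule symfun_eqI; simp add: symfun_scale.rep_eq plus_symfun.rep_eq algebra_simps)+

lemma symfun_scale_mult:
  fixes f g :: "'a :: comm_ring_1 symfun"
  shows "symfun_scale c f * g = symfun_scale c (f * g)" "f * symfun_scale c g = symfun_scale c (f * g)"
proof -
  show *: "symfun_scale c f * g = symfun_scale c (f * g)" for f g :: "'a symfun"
    by (rule symfun_eqI)
       (simp add: symfun_scale.rep_eq times_symfun.rep_eq sum_distrib_left case_prod_beta mult.assoc)
  show "f * symfun_scale c g = symfun_scale c (f * g)"
    using *[of g f] by (simp add: mult.commute)
qed

text \<open>The sum of all squarefree monomials of degree \<open>n\<close>.\<close>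

lift_definition elem_sym :: "nat \<Rightarrow> 'a :: comm_ring_1 symfun"
  is "\<lambda>n m. if size m = n \<and> (\<forall>i. count m i \<le> 1) then 1 else 0"
proof (intro conjI allI impI)
  fix n
  show "\<exists>d. \<forall>m :: nat multiset. size m > d \<longrightarrow>
      (if size m = n \<and> (\<forall>i. count m i \<le> 1) then 1 else 0 :: 'a) = 0"
    by (auto intro!: exI[of _ n])
  fix \<pi> :: "nat \<Rightarrow> nat" and m assume "bij \<pi>"
  hence "count (image_mset \<pi> m) (\<pi> i) = count m i" for i
    by (induction m) (auto dest: bij_is_inj injD)
  with \<open>bij \<pi>\<close> have "(\<forall>i. count (image_mset \<pi> m) i \<le> 1) \<longleftrightarrow> (\<forall>i. count m i \<le> 1)"
    by (metis bij_pointE)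
  thus "(if size (image_mset \<pi> m) = n \<and> (\<forall>i. count (image_mset \<pi> m) i \<le> 1) then 1 else 0 :: 'a) =
        (if size m = n \<and> (\<forall>i. count m i \<le> 1) then 1 else 0)"
    by simp
qed

lemma elem_sym_0 [simp]: "elem_sym 0 = 1"
  by transfer (auto simp: fun_eq_iff)

definition elem_gf :: "'a :: comm_ring_1 symfun fps" where
  "elem_gf = Abs_fps elem_sym"

definition q_int :: "'a :: comm_ring_1 \<Rightarrow> nat \<Rightarrow> 'a" where
  "q_int q n = (\<Sum>i<n. q ^ i)"

text \<open>The substitution of \<open>q t\<close> for \<open>t\<close>.\<close>

definition q_dilate :: "'a :: comm_ring_1 \<Rightarrow> 'a symfun fps \<Rightarrow> 'a symfun fps" where
  "q_dilate q F = Abs_fps (\<lambda>n. symfun_scale (q ^ n) (F $ n))"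

text \<open>
  Division of \<open>F(q t) - F(t)\<close>, whose constant coefficient is zero, by \<open>(q - 1) t\<close>:
  \<open>fps_shift 1\<close> divides by \<open>t\<close>.
\<close>

definition q_deriv :: "'a :: field \<Rightarrow> 'a symfun fps \<Rightarrow> 'a symfun fps" where
  "q_deriv q F = Abs_fps (\<lambda>n. symfun_scale (inverse (q - 1)) (fps_shift 1 (q_dilate q F - F) $ n))"

lemma q_deriv_correct:
  assumes "q \<noteq> 1"
  shows "fps_const (symfun_scale (q - 1) 1) * fps_X * q_deriv q F = q_dilate q F - F"
proof -
  interpret S: module "symfun_scale :: 'a \<Rightarrow> _" by (rule module_symfun_scale)
  show ?thesis
  proof (rule fps_ext)
    fix n
    show "(fps_const (symfun_scale (q - 1) 1) * fps_X * q_deriv q F) $ n = (q_dilate q F - F) $ n"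
      using assms by (cases n) (simp_all add: mult.assoc q_deriv_def q_dilate_def symfun_scale_mult)
  qed
qed

text \<open>
  The \<open>q\<close>-power sums are read off from the coefficients of the quotient of \<open>q_deriv q E\<close> by \<open>E\<close>,
  the elementary generating function.  Its constant coefficient is 1, so that it is
  invertible in the power series ring over symmetric functions.  Only \<open>n \<ge> 1\<close> is meaningful.
\<close>

definition q_power_sum :: "'a :: field \<Rightarrow> nat \<Rightarrow> 'a symfun" where
  "q_power_sum q n = (- 1) ^ (n - 1) * (q_deriv q elem_gf * fps_right_inverse elem_gf 1) $ (n - 1)"

lemma q_power_sum_gf:
  "Abs_fps (\<lambda>k. (- 1) ^ k * q_power_sum q (Suc k)) * elem_gf = q_deriv q elem_gf"
proof -
  have "elem_gf * fps_right_inverse elem_gf 1 = (1 :: 'a symfun fps)"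
    by (rule fps_right_inverse) (simp add: elem_gf_def)
  moreover have "Abs_fps (\<lambda>k. (- 1) ^ k * q_power_sum q (Suc k)) =
      q_deriv q elem_gf * fps_right_inverse elem_gf 1"
    by (rule fps_ext)
       (simp add: q_power_sum_def mult.assoc[symmetric] power_mult_distrib[symmetric])
  ultimately show ?thesis
    by (metis mult.assoc mult.commute mult_1_right)
qed

definition partitions_of :: "nat \<Rightarrow> nat list set" where
  "partitions_of n = {l. sorted_wrt (\<ge>) l \<and> (\<forall>x\<in>set l. x > 0) \<and> sum_list l = n}"

lemma finite_partitions_of: "finite (partitions_of n)"
proof (rule finite_subset)
  have "length l \<le> sum_list l" if "\<forall>x\<in>set l. x > 0" for l :: "nat list"
    using that by (induction l) (auto simp: Suc_le_eq intro: add_less_le_mono)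
  thus "partitions_of n \<subseteq> {l. set l \<subseteq> {..n} \<and> length l \<le> n}"
    by (auto simp: partitions_of_def member_le_sum_list)
  show "finite {l. set l \<subseteq> {..n} \<and> length l \<le> n}"
    by (rule finite_lists_length_le) simp
qed

definition q_power_sum_part :: "'a :: field \<Rightarrow> nat list \<Rightarrow> 'a symfun" where
  "q_power_sum_part q l = prod_list (map (q_power_sum q) l)"

definition part_sign :: "nat list \<Rightarrow> 'a :: comm_ring_1" where
  "part_sign l = (- 1) ^ (sum_list l - length l)"

definition q_z :: "'a :: field \<Rightarrow> nat list \<Rightarrow> 'a" where
  "q_z q l = inverse (\<Sum>u\<in>permutations_of_multiset (mset l).
     inverse (\<Prod>i<length u. q_int q (sum_list l - sum_list (take i u))))"

end

theory Submission
  imports Defs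
begin

text \<open>
  Comparing coefficients in \<open>(\<Sum>k. [p\<^sub>k\<^sub>+\<^sub>1] (-t)^k) E(t) = D E(t)\<close> gives
  \<open>[n] e\<^sub>n = \<Sum>k. (-1)^(k-1) [p\<^sub>k] e\<^sub>n\<^sub>-\<^sub>k\<close>, with the sum over \<open>1 \<le> k \<le> n\<close>.  Since \<open>q\<close> is transcendental,
  \<open>[n]\<close> is invertible, and iterating the recurrence writes \<open>e\<^sub>n\<close> as a sum over the compositions of
  \<open>n\<close>.  The coefficient of a composition depends on the order of its parts only through the product
  of \<open>q\<close>-integers, so collecting the rearrangements of each partition produces \<open>[z\<^sub>\<lambda>]\<close>.
\<close>

text \<open>The q-integer is the value at \<open>q\<close> of \<open>1 + x + ... + x^(n-1)\<close>,
  a nonzero polynomial with integer coefficients, so a zero would make \<open>q\<close>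
  algebraic.\<close>

lemma q_int_nonzero:
  fixes q :: "'a :: field_char_0"
  assumes "\<not> algebraic q" "n > 0"
  shows "q_int q n \<noteq> 0"
proof
  assume zero: "q_int q n = 0"
  define p :: "'a poly" where "p = (\<Sum>i<n. monom 1 i)"
  have coeff: "coeff p i = (if i < n then 1 else 0)" for i
    by (simp add: p_def coeff_sum)
  have "coeff p 0 \<noteq> 0"
    using assms(2) by (simp add: coeff)
  hence "p \<noteq> 0" by auto
  moreover have "poly p q = 0"
    using zero by (simp add: p_def poly_sum poly_monom q_int_def)
  moreover have "coeff p i \<in> \<int>" for i
    by (simp add: coeff)
  ultimately have "algebraic q"
    unfolding algebraic_def by blast
  with assms(1) show False ..
qed

lemma q_int_mult_minus_one: "(q - 1) * q_int q n = q ^ n - 1"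
  by (simp add: q_int_def power_diff_1_eq)

lemma elem_sym_recurrence:
  fixes q :: "'a :: field"
  assumes "q \<noteq> 1" "q_int q (Suc n) \<noteq> 0"
  shows "elem_sym (Suc n) = (\<Sum>k\<le>n. symfun_scale ((- 1) ^ k * inverse (q_int q (Suc n)))
           (q_power_sum q (Suc k) * elem_sym (n - k)))"
proof -
  interpret S: module "symfun_scale :: 'a \<Rightarrow> _" by (rule module_symfun_scale)
  \<comment> \<open>The signs in \<open>q_power_sum_gf\<close> are elements of the ring of symmetric
    functions; as scalars they can merge with the inverse q-integer.\<close>
  have sign: "(- 1) ^ k * f = symfun_scale ((- 1) ^ k) f" for k and f :: "'a symfun"
    by (induction k) (simp_all add: mult.assoc S.scale_minus_left)
  let ?e = "elem_sym (Suc n) :: 'a symfun"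
  \<comment> \<open>Since \<open>fps_shift 1\<close> lowers the index, coefficient \<open>n\<close>
    of the q-derivative carries \<open>(q^(n+1) - 1)/(q - 1)\<close>, the q-integer of
    \<open>n + 1\<close>.\<close>
  have "symfun_scale (q_int q (Suc n)) ?e =
        symfun_scale (inverse (q - 1)) (symfun_scale (q ^ Suc n) ?e - ?e)"
  proof -
    have "symfun_scale (q ^ Suc n) ?e - ?e = symfun_scale ((q - 1) * q_int q (Suc n)) ?e"
      by (simp add: q_int_mult_minus_one S.scale_left_diff_distrib)
    thus ?thesis using assms(1) by (simp add: mult.assoc[symmetric])
  qed
  also have "\<dots> = q_deriv q elem_gf $ n"
    by (simp add: q_deriv_def q_dilate_def elem_gf_def)
  also have "\<dots> = (\<Sum>k\<le>n. symfun_scale ((- 1) ^ k) (q_power_sum q (Suc k) * elem_sym (n - k)))"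
    unfolding q_power_sum_gf[symmetric]
    by (simp add: fps_mult_nth elem_gf_def atLeast0AtMost mult.assoc sign symfun_scale_mult)
  finally have "symfun_scale (inverse (q_int q (Suc n))) (symfun_scale (q_int q (Suc n)) ?e) =
      symfun_scale (inverse (q_int q (Suc n)))
        (\<Sum>k\<le>n. symfun_scale ((- 1) ^ k) (q_power_sum q (Suc k) * elem_sym (n - k)))"
    by (rule arg_cong)
  thus ?thesis
    using assms(2) by (simp add: S.scale_sum_right mult.commute)
qed

definition compositions_of :: "nat \<Rightarrow> nat list set" where
  "compositions_of n = {u. (\<forall>x\<in>set u. x > 0) \<and> sum_list u = n}"

text \<open>Ensures that the natural-number subtraction in the exponent of \<open>part_sign\<close>
  does not truncate.\<close>

lemma length_le_sum_list_pos:
  fixes u :: "nat list"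
  assumes "\<forall>x\<in>set u. x > 0"
  shows "length u \<le> sum_list u"
  using assms by (induction u) (auto simp: Suc_le_eq intro: add_less_le_mono)

lemma compositions_of_0: "compositions_of 0 = {[]}"
proof -
  have "u = []" if "u \<in> compositions_of 0" for u
    using that by (cases u) (auto simp: compositions_of_def)
  thus ?thesis by (auto simp: compositions_of_def)
qed

text \<open>Splitting off the first part, written \<open>Suc k\<close>, matches the index of the
  recurrence.\<close>

lemma compositions_of_Suc:
  "compositions_of (Suc n) =
     (\<lambda>(k, u). Suc k # u) ` (SIGMA k:{..n}. compositions_of (n - k))"
proof (intro equalityI subsetI)
  fix v assume v: "v \<in> compositions_of (Suc n)"
  then obtain x u where xu: "v = x # u"
    by (cases v) (auto simp: compositions_of_def)
  with v obtain k where "x = Suc k"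
    by (cases x) (auto simp: compositions_of_def)
  with v xu show "v \<in> (\<lambda>(k, u). Suc k # u) ` (SIGMA k:{..n}. compositions_of (n - k))"
    by (intro image_eqI[of _ _ "(k, u)"]) (auto simp: compositions_of_def)
qed (auto simp: compositions_of_def)

lemma finite_compositions_of: "finite (compositions_of n)"
proof (induction n rule: less_induct)
  case (less n)
  show ?case
  proof (cases n)
    case (Suc m)
    with less show ?thesis by (auto simp: compositions_of_Suc)
  qed (simp add: compositions_of_0)
qed

text \<open>The contribution of a single arrangement to the sum inside \<open>q_z\<close>; its
  factors are the q-integers of the sums of the nonempty tails of \<open>u\<close>.\<close>

definition tail_weight :: "'a :: field \<Rightarrow> nat list \<Rightarrow> 'a" where
  "tail_weight q u = inverse (\<Prod>i<length u. q_int q (sum_list u - sum_list (take i u)))"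

lemma tail_weight_Nil: "tail_weight q [] = 1"
  by (simp add: tail_weight_def)

text \<open>The factor at \<open>i = 0\<close> belongs to the whole list; in every later one
  \<open>x\<close> cancels from the difference, leaving the factors for \<open>u\<close>.\<close>

lemma tail_weight_Cons:
  "tail_weight q (x # u) = inverse (q_int q (x + sum_list u)) * tail_weight q u"
  by (simp add: tail_weight_def prod.lessThan_Suc_shift del: prod.lessThan_Suc)

lemma elem_sym_compositions:
  fixes q :: "'a :: field_char_0"
  assumes "\<not> algebraic q"
  shows "elem_sym n = (\<Sum>u\<in>compositions_of n.
           symfun_scale (part_sign u * tail_weight q u) (q_power_sum_part q u))"
proof (induction n rule: less_induct)
  case (less n)
  interpret S: module "symfun_scale :: 'a \<Rightarrow> _" by (rule module_symfun_scale)
  let ?h = "\<lambda>u. symfun_scale (part_sign u * tail_weight q u) (q_power_sum_part q u)"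
  show ?case
  proof (cases n)
    case 0
    thus ?thesis
      by (simp add: compositions_of_0 part_sign_def tail_weight_Nil q_power_sum_part_def)
  next
    case (Suc m)
    have q1: "q \<noteq> 1" using assms by auto
    let ?c = "\<lambda>k. (- 1) ^ k * inverse (q_int q (Suc m)) :: 'a"
    \<comment> \<open>One round of the recurrence prepends a part: the sign exponent grows by
      \<open>k\<close>, and the q-integer of \<open>Suc m\<close> is the new leading factor of the
      weight.\<close>
    have step: "symfun_scale (?c k) (q_power_sum q (Suc k) * ?h u) = ?h (Suc k # u)"
      if "k \<le> m" "u \<in> compositions_of (m - k)" for k u
    proof -
      have u: "\<forall>x\<in>set u. x > 0" "sum_list u = m - k"
        using that by (auto simp: compositions_of_def)
      have "length u \<le> sum_list u" by (rule length_le_sum_list_pos[OF u(1)])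
      hence "part_sign (Suc k # u) = (- 1 :: 'a) ^ k * part_sign u"
        by (simp add: part_sign_def flip: power_add)
      thus ?thesis
        using that(1) u(2)
        by (simp add: tail_weight_Cons q_power_sum_part_def symfun_scale_mult mult_ac)
    qed
    have "elem_sym n = (\<Sum>k\<le>m. symfun_scale (?c k) (q_power_sum q (Suc k) * elem_sym (m - k)))"
      unfolding Suc by (rule elem_sym_recurrence[OF q1 q_int_nonzero[OF assms]]) simp
    also have "\<dots> = (\<Sum>k\<le>m. symfun_scale (?c k)
                     (q_power_sum q (Suc k) * (\<Sum>u\<in>compositions_of (m - k). ?h u)))"
      using less Suc by (intro sum.cong) simp_all
    also have "\<dots> = (\<Sum>k\<le>m. \<Sum>u\<in>compositions_of (m - k). ?h (Suc k # u))"
      by (intro sum.cong) (simp_all only: sum_distrib_left S.scale_sum_right step atMost_iff cong: sum.cong)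
    also have "\<dots> = (\<Sum>p\<in>(SIGMA k:{..m}. compositions_of (m - k)). ?h (case p of (k, u) \<Rightarrow> Suc k # u))"
      by (subst sum.Sigma) (auto simp: finite_compositions_of case_prod_beta)
    also have "\<dots> = (\<Sum>u\<in>compositions_of n. ?h u)"
      unfolding Suc compositions_of_Suc by (subst sum.reindex) (auto simp: inj_on_def)
    finally show ?thesis .
  qed
qed

text \<open>Sorting sends each composition to a partition, and the fibre over a partition consists
  of its distinct rearrangements.\<close>

lemma sum_compositions_of_by_partition:
  fixes h :: "nat list \<Rightarrow> 'a :: comm_monoid_add"
  shows "(\<Sum>u\<in>compositions_of n. h u) =
    (\<Sum>l\<in>partitions_of n. \<Sum>u\<in>permutations_of_multiset (mset l). h u)"
proof -
  \<comment> \<open>Reversed because \<open>sort\<close> is increasing while partitions are listed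
    in decreasing order.\<close>
  let ?g = "\<lambda>u :: nat list. rev (sort u)"
  have sum_list_mset: "sum_list u = sum_mset (mset u)" for u :: "nat list"
    by (simp add: sum_mset_sum_list)
  have "?g ` compositions_of n \<subseteq> partitions_of n"
    by (auto simp: compositions_of_def partitions_of_def sorted_wrt_rev sum_list_mset)
  hence "(\<Sum>u\<in>compositions_of n. h u) =
      (\<Sum>l\<in>partitions_of n. \<Sum>u\<in>{u \<in> compositions_of n. ?g u = l}. h u)"
    by (intro sum.group[symmetric] finite_compositions_of finite_partitions_of)
  also have "\<dots> = (\<Sum>l\<in>partitions_of n. \<Sum>u\<in>permutations_of_multiset (mset l). h u)"
  proof (rule sum.cong[OF refl])
    fix l assume l: "l \<in> partitions_of n"
    have "?g u = l \<longleftrightarrow> mset u = mset l" for u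
    proof
      assume "mset u = mset l"
      moreover have "sorted (rev l)"
        using l by (simp add: partitions_of_def sorted_wrt_rev)
      ultimately have "sort u = rev l"
        by (intro properties_for_sort) simp_all
      thus "?g u = l" by simp
    qed (use mset_rev mset_sort in metis)
    moreover have "u \<in> compositions_of n" if "mset u = mset l" for u
      using l that mset_eq_setD[OF that]
      by (simp add: partitions_of_def compositions_of_def sum_list_mset)
    ultimately have "{u \<in> compositions_of n. ?g u = l} = permutations_of_multiset (mset l)"
      by (auto simp: permutations_of_multiset_def)
    thus "(\<Sum>u\<in>{u \<in> compositions_of n. ?g u = l}. h u) =
        (\<Sum>u\<in>permutations_of_multiset (mset l). h u)"
      by simp
  qed
  finally show ?thesis .
qed

theorem theorem4p3:
  fixes q :: "'k :: field_char_0" and n :: nat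
  assumes "\<not> algebraic q"
    and "n \<ge> 1"
  shows "elem_sym n = (\<Sum>l\<in>partitions_of n.
           symfun_scale (part_sign l * inverse (q_z q l)) (q_power_sum_part q l))"
proof -
  interpret S: module "symfun_scale :: 'k \<Rightarrow> _" by (rule module_symfun_scale)
  \<comment> \<open>Within a fibre only \<open>tail_weight\<close> varies; the sign and, by
    commutativity, the product of q-power sums factor out.\<close>
  have "(\<Sum>u\<in>permutations_of_multiset (mset l).
           symfun_scale (part_sign u * tail_weight q u) (q_power_sum_part q u)) =
        symfun_scale (part_sign l * inverse (q_z q l)) (q_power_sum_part q l)" for l
  proof -
    have perm: "sum_list u = sum_list l" "length u = length l"
        "q_power_sum_part q u = q_power_sum_part q l"
      if "u \<in> permutations_of_multiset (mset l)" for u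
    proof -
      have m: "mset u = mset l"
        using that by (simp add: permutations_of_multiset_def)
      show "sum_list u = sum_list l" by (metis m sum_mset_sum_list)
      show "length u = length l" by (metis m size_mset)
      show "q_power_sum_part q u = q_power_sum_part q l"
        unfolding q_power_sum_part_def by (metis m mset_map prod_mset_prod_list)
    qed
    \<comment> \<open>The two inverses cancel even for a vanishing sum, as
      \<open>inverse 0 = 0\<close>.\<close>
    have "inverse (q_z q l) = (\<Sum>u\<in>permutations_of_multiset (mset l). tail_weight q u)"
      by (simp add: q_z_def tail_weight_def perm cong: sum.cong)
    thus ?thesis
      by (simp add: perm part_sign_def sum_distrib_left S.scale_sum_left cong: sum.cong)
  qed
  thus ?thesis
    by (simp add: elem_sym_compositions[OF assms(1)] sum_compositions_of_by_partition)
qed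

end
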